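(* Let $X=\{P_1,\dots,P_r\}$ be a set of $r$ distinct points of $\mathbb P^n_{\mathbf k}\setminus\{x_n=0\}$, not contained in a hyperplane. Let $\{F_t\}_{t\ge1}$ be a family of elements of $I(X)^\perp$ such that $x_n\circ F_t=F_{t-1}$ for all $t>1$ and $x_n\circ F_1=0$. Then for all $t\ge1$ $$\langle F_1\rangle\subseteq\operatorname{Ann}_R(F_1)\circ F_2\subseteq\cdots\subseteq\operatorname{Ann}_R(F_t)\circ F_{t+1}\subseteq\operatorname{Ann}_R(F_{t+1})\circ F_{t+2}\subseteq(I(X)+(x_n))^\perp.$$
   Context: $\mathbf k$ is an algebraically closed field of characteristic zero, $n\ge1$, $R=\mathbf k[x_0,\dots,x_n]$ and $\Gamma=\mathbf k[y_0,\dots,y_n]$. $R$ acts on $\Gamma$ by differentiation: $f\circ g=f(\partial_{y_0},\dots,\partial_{y_n})(g)$, making $\Gamma$ an $R$-module. $\langle F_1\rangle$ is the $R$-submodule generated by $F_1$. For an ideal $I\subset R$, $I^\perp=\{G\in\Gamma: I\circ G=0\}$; for $G\in\Gamma$, $\operatorname{Ann}_R(G)=\{g\in R: g\circ G=0\}$; for an ideal $\mathfrak a$, $\mathfrak a\circ G=\{g\circ G: g\in\mathfrak a\}$. $I(X)\subset R$ is the homogeneous ideal of $X$. *)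

theory Defs
  imports
    "HOL-Library.Poly_Mapping"
    "HOL-Library.Set_Algebras"
    "HOL-Computational_Algebra.Polynomial"
begin

text \<open>
  Polynomials in finitely many variables, indexed by a finite type \<open>'v\<close>: a polynomial maps
  exponent vectors to coefficients, and the library makes this type a commutative ring.
  Both \<open>R\<close> and \<open>\<Gamma>\<close> are this type; they are distinguished only by the role their elements play.
\<close>

type_synonym ('v, 'k) mpoly = "('v \<Rightarrow>\<^sub>0 nat) \<Rightarrow>\<^sub>0 'k"

definition Var :: "'v \<Rightarrow> ('v, 'k::zero_neq_one) mpoly" where
  "Var v = Poly_Mapping.single (Poly_Mapping.single v 1) 1"

definition scal :: "'k \<Rightarrow> ('v, 'k::semiring_0) mpoly \<Rightarrow> ('v, 'k) mpoly" where
  "scal c f = Poly_Mapping.single 0 c * f"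

definition eval_mpoly :: "('v::finite, 'k::comm_semiring_1) mpoly \<Rightarrow> ('v \<Rightarrow> 'k) \<Rightarrow> 'k" where
  "eval_mpoly f p =
     (\<Sum>a\<in>Poly_Mapping.keys f. Poly_Mapping.lookup f a * (\<Prod>v\<in>UNIV. p v ^ Poly_Mapping.lookup a v))"

definition homogeneous :: "nat \<Rightarrow> ('v::finite, 'k::zero) mpoly \<Rightarrow> bool" where
  "homogeneous d f \<longleftrightarrow>
     (\<forall>a\<in>Poly_Mapping.keys f. (\<Sum>v\<in>UNIV. Poly_Mapping.lookup a v) = d)"


section \<open>Ideals\<close>

interpretation ring_module: module "(*) :: 'a::comm_ring_1 \<Rightarrow> 'a \<Rightarrow> 'a"
  by unfold_locales (simp_all add: algebra_simps)

abbreviation ideal_gen :: "'a::comm_ring_1 set \<Rightarrow> 'a set" where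
  "ideal_gen \<equiv> ring_module.span"


section \<open>Projective space and homogeneous ideals\<close>

definition proj_rel :: "(('v \<Rightarrow> 'k::field) \<times> ('v \<Rightarrow> 'k)) set" where
  "proj_rel = {(p, q). p \<noteq> (\<lambda>_. 0) \<and> q \<noteq> (\<lambda>_. 0) \<and> (\<exists>c. c \<noteq> 0 \<and> q = (\<lambda>v. c * p v))}"

text \<open>A point is the set of all its homogeneous coordinate vectors.\<close>

definition proj_space :: "('v \<Rightarrow> 'k::field) set set" where
  "proj_space = (UNIV - {\<lambda>_. 0}) // proj_rel"

definition proj_zeros :: "('v::finite, 'k::field) mpoly \<Rightarrow> ('v \<Rightarrow> 'k) set set" where
  "proj_zeros f = {P \<in> proj_space. \<forall>p\<in>P. eval_mpoly f p = 0}"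

definition hyperplane :: "('v::finite \<Rightarrow> 'k::field) set set \<Rightarrow> bool" where
  "hyperplane H \<longleftrightarrow> (\<exists>l. l \<noteq> 0 \<and> homogeneous 1 l \<and> H = proj_zeros l)"

definition hom_ideal :: "('v::finite \<Rightarrow> 'k::field) set set \<Rightarrow> ('v, 'k) mpoly set" where
  "hom_ideal X = ideal_gen {f. (\<exists>d. homogeneous d f) \<and> X \<subseteq> proj_zeros f}"


section \<open>The action by differentiation\<close>

definition partial :: "'v \<Rightarrow> ('v, 'k::comm_ring_1) mpoly \<Rightarrow> ('v, 'k) mpoly" where
  "partial v g =
     (\<Sum>b\<in>Poly_Mapping.keys g.
        Poly_Mapping.single (b - Poly_Mapping.single v 1)
          (of_nat (Poly_Mapping.lookup b v) * Poly_Mapping.lookup g b))"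

text \<open>
  The differential monomial \<open>\<Prod>\<^sub>v \<partial>\<^sub>v\<^bsup>a v\<^esup>\<close>. The composition over all variables is a
  \<^const>\<open>Finite_Set.fold\<close>, which is meaningful because partial derivatives commute
  (\<open>partial_commute\<close> below).
\<close>

definition diff_monom :: "('v::finite \<Rightarrow>\<^sub>0 nat) \<Rightarrow> ('v, 'k::comm_ring_1) mpoly \<Rightarrow> ('v, 'k) mpoly" where
  "diff_monom a g = Finite_Set.fold (\<lambda>v. partial v ^^ Poly_Mapping.lookup a v) g UNIV"

definition diff_act ::
    "('v::finite, 'k::comm_ring_1) mpoly \<Rightarrow> ('v, 'k) mpoly \<Rightarrow> ('v, 'k) mpoly" (infixr \<open>\<odot>\<close> 75) where
  "f \<odot> g = (\<Sum>a\<in>Poly_Mapping.keys f. scal (Poly_Mapping.lookup f a) (diff_monom a g))"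

definition perp :: "('v::finite, 'k::comm_ring_1) mpoly set \<Rightarrow> ('v, 'k) mpoly set" where
  "perp I = {G. \<forall>f\<in>I. f \<odot> G = 0}"

definition Ann :: "('v::finite, 'k::comm_ring_1) mpoly \<Rightarrow> ('v, 'k) mpoly set" where
  "Ann G = {g. g \<odot> G = 0}"

definition ideal_act ::
    "('v::finite, 'k::comm_ring_1) mpoly set \<Rightarrow> ('v, 'k) mpoly \<Rightarrow> ('v, 'k) mpoly set" where
  "ideal_act I G = (\<lambda>g. g \<odot> G) ` I"


section \<open>The action is a module structure\<close>

lemma lookup_scal: "Poly_Mapping.lookup (scal c f) a = c * Poly_Mapping.lookup f a"
  unfolding scal_def mult_map_scale_conv_mult[symmetric] by (simp add: Poly_Mapping.map.rep_eq when_def)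

lemma lookup_partial:
  "Poly_Mapping.lookup (partial v g) a =
     of_nat (Suc (Poly_Mapping.lookup a v)) * Poly_Mapping.lookup g (a + Poly_Mapping.single v 1)"
proof -
  let ?e = "Poly_Mapping.single v (1::nat)"
  have *: "(of_nat (Poly_Mapping.lookup b v) * Poly_Mapping.lookup g b when b - ?e = a) =
      (of_nat (Poly_Mapping.lookup b v) * Poly_Mapping.lookup g b when b = a + ?e)" for b
  proof (cases "Poly_Mapping.lookup b v = 0")
    case False
    have "b - ?e + ?e = b"
      using False by (intro poly_mapping_eqI) (auto simp: lookup_add lookup_minus lookup_single when_def)
    then have "b - ?e = a \<longleftrightarrow> b = a + ?e" by auto
    then show ?thesis by simp
  qed simp
  have "Poly_Mapping.lookup (partial v g) a = (\<Sum>b\<in>Poly_Mapping.keys g.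
      (of_nat (Poly_Mapping.lookup b v) * Poly_Mapping.lookup g b when b = a + ?e))"
    unfolding partial_def lookup_sum lookup_single * ..
  also have "\<dots> = of_nat (Poly_Mapping.lookup (a + ?e) v) * Poly_Mapping.lookup g (a + ?e)"
    by (auto simp: when_def sum.delta in_keys_iff)
  finally show ?thesis by (simp add: lookup_add)
qed

lemma partial_commute: "partial v (partial w g) = partial w (partial v g)"
proof (cases "v = w")
  case False
  let ?e = "Poly_Mapping.single v (1::nat)" and ?e' = "Poly_Mapping.single w (1::nat)"
  show ?thesis
  proof (rule poly_mapping_eqI)
    fix a
    have 1: "Poly_Mapping.lookup (a + ?e) w = Poly_Mapping.lookup a w"
            "Poly_Mapping.lookup (a + ?e') v = Poly_Mapping.lookup a v"
      using False by (simp_all add: lookup_add lookup_single)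
    have 2: "a + ?e + ?e' = a + ?e' + ?e"
      by (simp only: add.assoc add.commute[of ?e])
    show "Poly_Mapping.lookup (partial v (partial w g)) a =
        Poly_Mapping.lookup (partial w (partial v g)) a"
      unfolding lookup_partial 1 2 by (rule mult.left_commute)
  qed
qed simp

lemma partial_add: "partial v (g + h) = partial v g + partial v h"
  by (intro poly_mapping_eqI) (simp only: lookup_partial lookup_add distrib_left)

lemma partial_scal: "partial v (scal c g) = scal c (partial v g)"
  by (intro poly_mapping_eqI) (simp only: lookup_partial lookup_scal ac_simps)

lemma partial_pow_commute:
  "(partial v ^^ i) ((partial w ^^ j) g) = (partial w ^^ j) ((partial v ^^ i) g)"
proof -
  have 1: "partial v ((partial w ^^ j) g) = (partial w ^^ j) (partial v g)" for g
  proof (induction j)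
    case (Suc j)
    then show ?case by (simp add: partial_commute[of v w])
  qed simp
  show ?thesis by (induction i) (simp_all add: 1)
qed

lemma partial_pow_add: "(partial v ^^ i) (g + h) = (partial v ^^ i) g + (partial v ^^ i) h"
  by (induction i) (simp_all add: partial_add)

lemma partial_pow_scal: "(partial v ^^ i) (scal c g) = scal c ((partial v ^^ i) g)"
  by (induction i) (simp_all add: partial_scal)

lemma diff_monom_commute: "comp_fun_commute (\<lambda>v. partial v ^^ Poly_Mapping.lookup a v)"
  by unfold_locales (simp add: fun_eq_iff partial_pow_commute)

lemma fold_insert_diff:
  assumes "finite S" "w \<notin> S"
  shows "Finite_Set.fold (\<lambda>v. partial v ^^ Poly_Mapping.lookup a v) g (insert w S) =
   (partial w ^^ Poly_Mapping.lookup a w) (Finite_Set.fold (\<lambda>v. partial v ^^ Poly_Mapping.lookup a v) g S)"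
proof -
  interpret comp_fun_commute "\<lambda>v. partial v ^^ Poly_Mapping.lookup a v"
    by (rule diff_monom_commute)
  show ?thesis using assms by (rule fold_insert)
qed

lemma fold_diff_add:
  fixes S :: "'v::finite set"
  shows "Finite_Set.fold (\<lambda>v. partial v ^^ Poly_Mapping.lookup a v) (g + h) S =
   Finite_Set.fold (\<lambda>v. partial v ^^ Poly_Mapping.lookup a v) g S +
   Finite_Set.fold (\<lambda>v. partial v ^^ Poly_Mapping.lookup a v) h S"
  using finite[of S]
proof (induction S rule: finite_induct)
  case (insert u S)
  show ?case
    unfolding fold_insert_diff[OF insert.hyps] insert.IH by (rule partial_pow_add)
qed simp

lemma fold_diff_scal:
  fixes S :: "'v::finite set"
  shows "Finite_Set.fold (\<lambda>v. partial v ^^ Poly_Mapping.lookup a v) (scal c g) S =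
   scal c (Finite_Set.fold (\<lambda>v. partial v ^^ Poly_Mapping.lookup a v) g S)"
  using finite[of S]
proof (induction S rule: finite_induct)
  case (insert u S)
  show ?case
    unfolding fold_insert_diff[OF insert.hyps] insert.IH by (rule partial_pow_scal)
qed simp

lemma fold_diff_pow:
  fixes S :: "'v::finite set"
  shows "Finite_Set.fold (\<lambda>v. partial v ^^ Poly_Mapping.lookup a v) ((partial w ^^ i) g) S =
   (partial w ^^ i) (Finite_Set.fold (\<lambda>v. partial v ^^ Poly_Mapping.lookup a v) g S)"
  using finite[of S]
proof (induction S rule: finite_induct)
  case (insert u S)
  show ?case
    unfolding fold_insert_diff[OF insert.hyps] insert.IH by (rule partial_pow_commute)
qed simp

lemma fold_diff_comp:
  fixes S :: "'v::finite set"
  shows "Finite_Set.fold (\<lambda>v. partial v ^^ Poly_Mapping.lookup (a + b) v) g S =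
   Finite_Set.fold (\<lambda>v. partial v ^^ Poly_Mapping.lookup a v)
     (Finite_Set.fold (\<lambda>v. partial v ^^ Poly_Mapping.lookup b v) g S) S"
  using finite[of S]
proof (induction S rule: finite_induct)
  case (insert u S)
  show ?case
    unfolding fold_insert_diff[OF insert.hyps] insert.IH fold_diff_pow lookup_add[of a b u] funpow_add
    by simp
qed simp

lemma fold_diff_zero:
  fixes S :: "'v::finite set"
  shows "Finite_Set.fold (\<lambda>v. partial v ^^ Poly_Mapping.lookup 0 v) g S = g"
  using finite[of S]
proof (induction S rule: finite_induct)
  case (insert w S)
  show ?case
    unfolding fold_insert_diff[OF insert.hyps] insert.IH by simp
qed simp

lemma diff_monom_add: "diff_monom a (g + h) = diff_monom a g + diff_monom a h"
  unfolding diff_monom_def by (rule fold_diff_add)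

lemma diff_monom_scal: "diff_monom a (scal c g) = scal c (diff_monom a g)"
  unfolding diff_monom_def by (rule fold_diff_scal)

lemma diff_monom_comp: "diff_monom (a + b) g = diff_monom a (diff_monom b g)"
  unfolding diff_monom_def by (rule fold_diff_comp)

lemma diff_monom_zero: "diff_monom 0 g = g"
  unfolding diff_monom_def by (rule fold_diff_zero)

lemma scal_simps:
  "scal c (g + h) = scal c g + scal c h" "scal (c + d) g = scal c g + scal d g"
  "scal c (scal d g) = scal (c * d) g" "scal 0 g = 0" "scal 1 g = g" "scal c 0 = 0"
  for g h :: "('v, 'k::comm_ring_1) mpoly"
  unfolding scal_def
  by (simp_all only: distrib_left distrib_right single_add mult.assoc[symmetric] mult_single
        add_0 single_zero single_one mult_zero_left mult_zero_right mult_1)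

lemma diff_act_superset:
  assumes "finite A" "Poly_Mapping.keys f \<subseteq> A"
  shows "f \<odot> g = (\<Sum>a\<in>A. scal (Poly_Mapping.lookup f a) (diff_monom a g))"
  unfolding diff_act_def using assms
  by (intro sum.mono_neutral_left) (auto simp: in_keys_iff scal_simps)

lemma diff_act_single: "Poly_Mapping.single a c \<odot> g = scal c (diff_monom a g)"
  by (subst diff_act_superset[of "{a}"]) auto

lemma diff_act_add_left: "(f + f') \<odot> g = f \<odot> g + f' \<odot> g"
proof -
  let ?A = "Poly_Mapping.keys f \<union> Poly_Mapping.keys f'"
  show ?thesis
    using keys_add[of f f']
    by (simp add: diff_act_superset[of ?A] lookup_add scal_simps sum.distrib)
qed

lemma diff_act_add_right: "f \<odot> (g + h) = f \<odot> g + f \<odot> h"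
  by (simp add: diff_act_def diff_monom_add scal_simps sum.distrib)

lemma diff_act_zero: "0 \<odot> g = 0" "f \<odot> 0 = 0"
  using diff_act_add_right[of f 0 0] by (simp_all add: diff_act_def)

lemma mpoly_induct [case_names zero single add]:
  fixes f :: "('v, 'k::comm_ring_1) mpoly"
  assumes "P 0" "\<And>a c. P (Poly_Mapping.single a c)" "\<And>f g. P f \<Longrightarrow> P g \<Longrightarrow> P (f + g)"
  shows "P f"
proof (induction f rule: update_induct)
  case (update f a b)
  have "Poly_Mapping.update a b f = f + Poly_Mapping.single a b"
    using update by (intro poly_mapping_eqI) (auto simp: lookup_update lookup_add lookup_single in_keys_iff when_def)
  then show ?case using assms update by simp
qed (rule assms)

lemma diff_act_mult: "(f * f') \<odot> g = f \<odot> (f' \<odot> g)"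
proof (induction f rule: mpoly_induct)
  case (single a c)
  show ?case
  proof (induction f' rule: mpoly_induct)
    case (single b d)
    show ?case
      by (simp add: mult_single diff_act_single diff_monom_comp diff_monom_scal scal_simps)
  next
    case zero
    show ?case by (simp add: diff_act_zero)
  qed (simp add: distrib_left diff_act_add_left diff_act_add_right)
qed (simp_all add: distrib_right diff_act_add_left diff_act_zero)

interpretation diff_module:
  module "diff_act :: ('v::finite, 'k::comm_ring_1) mpoly \<Rightarrow> ('v, 'k) mpoly \<Rightarrow> ('v, 'k) mpoly"
proof
  show "(1 :: ('v, 'k) mpoly) \<odot> g = g" for g
    by (simp add: diff_act_single diff_monom_zero scal_simps flip: single_one)
qed (simp_all add: diff_act_mult diff_act_add_left diff_act_add_right)

abbreviation submodule_gen ::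
    "('v::finite, 'k::comm_ring_1) mpoly set \<Rightarrow> ('v, 'k) mpoly set" where
  "submodule_gen \<equiv> diff_module.span"

end

theory Submission
  imports Defs
begin

theorem lemma3p10:
  fixes n r :: nat
    and idx :: "nat \<Rightarrow> 'v::finite"
    and P :: "nat \<Rightarrow> ('v \<Rightarrow> 'k::{alg_closed_field, field_char_0}) set"
    and X :: "('v \<Rightarrow> 'k) set set"
    and F :: "nat \<Rightarrow> ('v, 'k) mpoly"
    and x :: "nat \<Rightarrow> ('v, 'k) mpoly"
  assumes "n \<ge> 1"
    and "bij_betw idx {0..n} (UNIV :: 'v set)"
    and "\<And>i. x i = Var (idx i)"
    and "inj_on P {1..r}"
    and "X = P ` {1..r}"
    and "X \<subseteq> proj_space - proj_zeros (x n)"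
    and "\<not> (\<exists>H. hyperplane H \<and> X \<subseteq> H)"
    and "\<And>t. t \<ge> 1 \<Longrightarrow> F t \<in> perp (hom_ideal X)"
    and "\<And>t. t > 1 \<Longrightarrow> x n \<odot> F t = F (t - 1)"
    and "x n \<odot> F 1 = 0"
  shows "\<forall>t\<ge>1.
      submodule_gen {F 1} \<subseteq> ideal_act (Ann (F 1)) (F 2)
    \<and> (\<forall>s\<in>{1..t}. ideal_act (Ann (F s)) (F (s + 1)) \<subseteq> ideal_act (Ann (F (s + 1))) (F (s + 2)))
    \<and> ideal_act (Ann (F (t + 1))) (F (t + 2)) \<subseteq> perp (hom_ideal X + ideal_gen {x n})"
proof -
  let ?x = "x n"
  have step: "g \<odot> F t = (g * ?x) \<odot> F (t + 1)" if "t \<ge> 1" for g t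
    using assms(9)[of "t + 1"] that by (simp add: diff_act_mult)
  have "submodule_gen {F 1} \<subseteq> ideal_act (Ann (F 1)) (F 2)"
  proof
    fix G assume "G \<in> submodule_gen {F 1}"
    then obtain h where "G = h \<odot> F 1"
      by (auto simp: diff_module.span_singleton)
    then have "G = (h * ?x) \<odot> F 2"
      using step[of 1 h] by (simp add: numeral_2_eq_2)
    moreover have "h * ?x \<in> Ann (F 1)"
      using assms(10) by (simp add: Ann_def diff_act_mult diff_act_zero)
    ultimately show "G \<in> ideal_act (Ann (F 1)) (F 2)"
      by (auto simp: ideal_act_def)
  qed
  moreover have "ideal_act (Ann (F s)) (F (s + 1)) \<subseteq> ideal_act (Ann (F (s + 1))) (F (s + 2))"
    if "s \<ge> 1" for s
  proof
    fix G assume "G \<in> ideal_act (Ann (F s)) (F (s + 1))"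
    then obtain g where g: "g \<odot> F s = 0" "G = g \<odot> F (s + 1)"
      by (auto simp: ideal_act_def Ann_def)
    have "g * ?x \<in> Ann (F (s + 1))"
      using g(1) step[OF that] by (simp add: Ann_def)
    moreover have "G = (g * ?x) \<odot> F (s + 2)"
      using g(2) step[of "s + 1"] by simp
    ultimately show "G \<in> ideal_act (Ann (F (s + 1))) (F (s + 2))"
      by (auto simp: ideal_act_def)
  qed
  moreover have "ideal_act (Ann (F s)) (F (s + 1)) \<subseteq> perp (hom_ideal X + ideal_gen {?x})"
    if "s \<ge> 1" for s
  proof
    fix G assume "G \<in> ideal_act (Ann (F s)) (F (s + 1))"
    then obtain g where g: "g \<odot> F s = 0" "G = g \<odot> F (s + 1)"
      by (auto simp: ideal_act_def Ann_def)
    have "f \<odot> G = 0" if "f \<in> hom_ideal X" for f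
    proof -
      have "f \<odot> G = (g * f) \<odot> F (s + 1)"
        unfolding g(2) diff_act_mult[symmetric] by (simp only: mult.commute)
      also have "\<dots> = g \<odot> (f \<odot> F (s + 1))"
        by (rule diff_act_mult)
      also have "f \<odot> F (s + 1) = 0"
        using assms(8)[of "s + 1"] that by (simp add: perp_def)
      finally show ?thesis by (simp add: diff_act_zero)
    qed
    moreover have "(k * ?x) \<odot> G = 0" for k
    proof -
      have "(k * ?x) \<odot> G = (k * (g * ?x)) \<odot> F (s + 1)"
        unfolding g(2) diff_act_mult[symmetric] by (simp only: ac_simps)
      also have "\<dots> = k \<odot> ((g * ?x) \<odot> F (s + 1))"
        by (rule diff_act_mult)
      also have "(g * ?x) \<odot> F (s + 1) = 0"
        using g(1) step[OF that, of g] by simp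
      finally show ?thesis by (simp add: diff_act_zero)
    qed
    ultimately have "(f + k * ?x) \<odot> G = 0" if "f \<in> hom_ideal X" for f k
      using that by (simp only: diff_act_add_left add_0)
    then show "G \<in> perp (hom_ideal X + ideal_gen {?x})"
      unfolding perp_def ring_module.span_singleton set_plus_def by blast
  qed
  from this[of "t + 1" for t] have
    "ideal_act (Ann (F (t + 1))) (F (t + 2)) \<subseteq> perp (hom_ideal X + ideal_gen {?x})" for t
    by simp
  ultimately show ?thesis by simp
qed

end
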